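(* Let $\mathbb{D}_{3,5}=\mathring{\mathbb{D}}^3_1\cup\mathbb{D}^3_2$ be a positive basis of size $5$ in $\mathbb{R}^3$, where $\mathring{\mathbb{D}}^3_1$ is a (minimal, two-element) sub-positive basis of a one-dimensional subspace $L_1$ and $\mathbb{D}^3_2$ is a minimal (three-element) sub-positive basis of a two-dimensional subspace $L_2$, with $L_1\oplus L_2=\mathbb{R}^3$ and $L_1\cap L_2=\{0\}$. If $\mathbb{D}_{3,5}$ is optimal over $\Omega$, then $L_1\perp L_2$.
   Context: The positive span $\mathrm{pspan}(S)$ of a finite set $S$ of vectors is the set of linear combinations of elements of $S$ with nonnegative coefficients. A finite set $S$ is positively independent if $d\notin\mathrm{pspan}(S\setminus\{d\})$ for all $d\in S$. A positive basis of a subspace $L$ of $\mathbb{R}^n$ is a positively independent set with positive span equal to $L$. All vectors in positive bases are assumed to be unit vectors. A positive basis of an $m$-dimensional space is minimal if it has $m+1$ elements. A sub-positive basis of a subspace $L$ is a subset of a positive basis of $\mathbb{R}^n$ with positive span equal to $L$. The cosine measure of a finite set $S$ of non-zero vectors of $\mathbb{R}^n$ is $\mathrm{cm}(S)=\min_{u\in\mathbb{R}^n,\|u\|=1}\max_{d\in S}\frac{u^\top d}{\|d\|}$. A positive basis of $\mathbb{R}^n$ of size $s$ is optimal over a non-empty set $\mathbb{P}$ of positive bases if its cosine measure is at least $\mathrm{cm}(\mathbb{D}')$ for every positive basis $\mathbb{D}'\in\mathbb{P}$ of size $s$ of $\mathbb{R}^n$. For $n=3$, $s=5$, $\Omega$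 is the set of positive bases of $\mathbb{R}^3$ of size $5$ that admit a partition into two subsets which are minimal sub-positive bases of subspaces $L_1$ and $L_2$ respectively, where $\dim L_i\ge 1$, $\mathbb{R}^3=L_1\oplus L_2$ and $L_1\cap L_2=\{0\}$. *)

theory Defs
  imports "HOL-Analysis.Analysis"
begin

definition pspan :: "'a::real_vector set \<Rightarrow> 'a set" where
  "pspan S = {\<Sum>d\<in>S. c d *\<^sub>R d | c. \<forall>d\<in>S. 0 \<le> c d}"

definition positively_independent :: "'a::real_vector set \<Rightarrow> bool" where
  "positively_independent S \<longleftrightarrow> finite S \<and> (\<forall>d\<in>S. d \<notin> pspan (S - {d}))"

(* The unit-norm convention for positive bases is part of the definition. *)
definition positive_basis :: "'a::euclidean_space set \<Rightarrow> 'a set \<Rightarrow> bool" where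
  "positive_basis L S \<longleftrightarrow>
     subspace L \<and> positively_independent S \<and> pspan S = L \<and> (\<forall>d\<in>S. norm d = 1)"

definition sub_positive_basis :: "'a::euclidean_space set \<Rightarrow> 'a set \<Rightarrow> bool" where
  "sub_positive_basis L S \<longleftrightarrow>
     subspace L \<and> pspan S = L \<and> (\<exists>B. positive_basis UNIV B \<and> S \<subseteq> B)"

definition minimal_sub_positive_basis :: "'a::euclidean_space set \<Rightarrow> 'a set \<Rightarrow> bool" where
  "minimal_sub_positive_basis L S \<longleftrightarrow> sub_positive_basis L S \<and> card S = dim L + 1"

definition direct_sum_decomposition :: "'a::real_vector set \<Rightarrow> 'a set \<Rightarrow> bool" where
  "direct_sum_decomposition L\<^sub>1 L\<^sub>2 \<longleftrightarrow>
     subspace L\<^sub>1 \<and> subspace L\<^sub>2 \<and> {x + y | x y. x \<in> L\<^sub>1 \<and> y \<in> L\<^sub>2} = UNIV \<and> L\<^sub>1 \<inter> L\<^sub>2 = {0}"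

(* The infimum is a minimum, see cosine_measure_attained below. *)
definition cosine_measure :: "'a::euclidean_space set \<Rightarrow> real" where
  "cosine_measure S = (INF u\<in>sphere 0 1. Max ((\<lambda>d. (u \<bullet> d) / norm d) ` S))"

definition optimal_over :: "'a::euclidean_space set set \<Rightarrow> 'a set \<Rightarrow> bool" where
  "optimal_over P D \<longleftrightarrow> positive_basis UNIV D \<and>
     (\<forall>D'\<in>P. positive_basis UNIV D' \<and> card D' = card D \<longrightarrow>
        cosine_measure D' \<le> cosine_measure D)"

definition Omega :: "(real^3) set set" where
  "Omega = {D. positive_basis UNIV D \<and> card D = 5 \<and>
     (\<exists>D\<^sub>1 D\<^sub>2 L\<^sub>1 L\<^sub>2. D = D\<^sub>1 \<union> D\<^sub>2 \<and> D\<^sub>1 \<inter> D\<^sub>2 = {} \<and>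
        minimal_sub_positive_basis L\<^sub>1 D\<^sub>1 \<and> minimal_sub_positive_basis L\<^sub>2 D\<^sub>2 \<and>
        1 \<le> dim L\<^sub>1 \<and> 1 \<le> dim L\<^sub>2 \<and> direct_sum_decomposition L\<^sub>1 L\<^sub>2)}"

lemma continuous_on_Max_inner:
  fixes S :: "'a::euclidean_space set"
  assumes "finite S" "S \<noteq> {}"
  shows "continuous_on A (\<lambda>u. Max ((\<lambda>d. (u \<bullet> d) / norm d) ` S))"
  using assms
proof (induction S rule: finite_ne_induct)
  case (singleton x)
  then show ?case by (simp add: divide_inverse) (intro continuous_intros)
next
  case (insert x F)
  have "continuous_on A (\<lambda>u. max ((u \<bullet> x) / norm x) (Max ((\<lambda>d. (u \<bullet> d) / norm d) ` F)))"
    unfolding divide_inverse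
    using insert.IH by (intro continuous_on_max continuous_intros) (simp add: divide_inverse)
  then show ?case using insert by simp
qed

lemma cosine_measure_attained:
  fixes S :: "'a::euclidean_space set"
  assumes "finite S" "S \<noteq> {}"
  shows "\<exists>u. norm u = 1 \<and> cosine_measure S = Max ((\<lambda>d. (u \<bullet> d) / norm d) ` S) \<and>
    (\<forall>v. norm v = 1 \<longrightarrow> cosine_measure S \<le> Max ((\<lambda>d. (v \<bullet> d) / norm d) ` S))"
proof -
  let ?f = "\<lambda>u. Max ((\<lambda>d. (u \<bullet> d) / norm d) ` S)"
  have "sphere (0::'a) 1 \<noteq> {}" by simp
  then obtain u where u: "u \<in> sphere 0 1" "\<forall>v\<in>sphere 0 1. ?f u \<le> ?f v"
    using continuous_attains_inf[OF compact_sphere _ continuous_on_Max_inner[OF assms]] by blast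
  have "cosine_measure S = ?f u"
    unfolding cosine_measure_def
    using u by (intro cInf_eq_minimum) auto
  with u show ?thesis by (intro exI[of _ u]) auto
qed

end

theory Submission
  imports Defs
begin

text \<open>
  The value to beat is \<open>1 / sqrt 5\<close>: it is attained by a cross-shaped basis, made of a vertical pair
  \<open>\<plusminus>e\<close> and three horizontal unit vectors at mutual angles of 120 degrees. An optimal basis therefore
  has cosine measure at least \<open>1 / sqrt 5\<close>, and it remains to see that an oblique basis, consisting
  of a pair \<open>\<plusminus>a\<close> and three unit vectors in a plane with unit normal \<open>n\<close>, with \<open>a\<close> neither in the
  plane nor parallel to \<open>n\<close>, stays strictly below.

  In the plane there is a unit vector \<open>w\<close> that makes an angle of at least 60 degrees with each of
  the three coplanar basis vectors (\<open>exists_unit_in_plane_inner_le_half\<close>). Adding a multiple of the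
  normal does not change these inner products, so \<open>v = w + s n\<close> makes with the coplanar vectors an
  angle of cosine at most \<open>1 / (2 sqrt (1 + s\<^sup>2))\<close>, which is less than \<open>1 / sqrt 5\<close> as soon as
  \<open>s\<^sup>2 > 1/4\<close>. With respect to \<open>\<plusminus>a\<close>, only \<open>\<bar>w \<bullet> a + s (n \<bullet> a)\<bar>\<close> matters. The sign of \<open>s\<close> can be
  chosen such that the two terms compensate each other, and since \<open>\<bar>n \<bullet> a\<bar> < 1\<close> there is enough room
  to keep this quantity below \<open>sqrt ((1 + s\<^sup>2) / 5)\<close> as well (\<open>exists_height\<close>). The
  direction of \<open>v\<close> then witnesses that the cosine measure is less than \<open>1 / sqrt 5\<close>
  (\<open>cosine_measure_oblique_less\<close>).
\<close>

section \<open>Positive spans and positive independence\<close>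

text \<open>Adding a large constant to all coefficients of a linear combination of \<open>S\<close> makes them
  nonnegative, and does not change its value when the vectors of \<open>S\<close> sum to zero.\<close>

lemma pspan_eq_span_if_sum_eq_0:
  fixes S :: "'a::real_vector set"
  assumes "finite S" "\<Sum>S = 0"
  shows "pspan S = span S"
proof
  show "pspan S \<subseteq> span S"
    unfolding pspan_def by (auto intro: span_sum span_scale span_base)
  show "span S \<subseteq> pspan S"
  proof
    fix x assume "x \<in> span S"
    then obtain c where x: "x = (\<Sum>d\<in>S. c d *\<^sub>R d)"
      using span_finite[OF assms(1)] by auto
    define M where "M = (\<Sum>d\<in>S. \<bar>c d\<bar>)"
    have "0 \<le> c d + M" if "d \<in> S" for d
      using member_le_sum[of d S "\<lambda>d. \<bar>c d\<bar>"] that assms(1) unfolding M_def by fastforce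
    moreover have "x = (\<Sum>d\<in>S. (c d + M) *\<^sub>R d)"
      using assms(2) by (simp add: x scaleR_add_left sum.distrib flip: scaleR_sum_right)
    ultimately show "x \<in> pspan S"
      unfolding pspan_def by (intro CollectI exI[of _ "\<lambda>d. c d + M"]) auto
  qed
qed

text \<open>Each vector is separated from the positive span of the others by the half-space that it
  defines itself.\<close>

lemma positively_independent_if_inner_le_0:
  fixes S :: "'a::real_inner set"
  assumes "finite S" "0 \<notin> S"
    and obtuse: "\<And>x y. x \<in> S \<Longrightarrow> y \<in> S \<Longrightarrow> x \<noteq> y \<Longrightarrow> x \<bullet> y \<le> 0"
  shows "positively_independent S"
  unfolding positively_independent_def
proof (intro conjI ballI notI)
  fix d assume d: "d \<in> S" "d \<in> pspan (S - {d})"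
  then obtain c where c: "d = (\<Sum>e\<in>S - {d}. c e *\<^sub>R e)" "\<forall>e\<in>S - {d}. 0 \<le> c e"
    unfolding pspan_def by auto
  have "d \<bullet> d = (\<Sum>e\<in>S - {d}. c e * (e \<bullet> d))"
    by (subst c(1)) (simp add: inner_sum_left)
  also have "\<dots> \<le> 0"
    using c(2) obtuse d(1) by (intro sum_nonpos mult_nonneg_nonpos) auto
  finally have "d = 0"
    by (metis inner_eq_zero_iff inner_ge_zero order_antisym)
  then show False
    using d(1) assms(2) by simp
qed (rule assms)

lemma pspan_base:
  assumes "finite S" "d \<in> S"
  shows "d \<in> pspan S"
proof -
  have "(\<Sum>e\<in>S. (if e = d then 1 else 0) *\<^sub>R e) = (\<Sum>e\<in>S. if e = d then e else 0)"
    by (intro sum.cong) auto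
  also have "\<dots> = d"
    using assms by simp
  finally show ?thesis
    unfolding pspan_def by (intro CollectI exI[of _ "\<lambda>e. if e = d then 1 else 0"]) auto
qed

section \<open>Bounding the cosine measure\<close>

lemma cosine_measure_less:
  fixes S :: "'a::euclidean_space set"
  assumes "finite S" "S \<noteq> {}" "\<And>d. d \<in> S \<Longrightarrow> norm d = 1"
    and "v \<noteq> 0" and less: "\<And>d. d \<in> S \<Longrightarrow> v \<bullet> d < k * norm v"
  shows "cosine_measure S < k"
proof -
  define u where "u = v /\<^sub>R norm v"
  have "norm u = 1"
    using \<open>v \<noteq> 0\<close> by (simp add: u_def)
  then have "cosine_measure S \<le> Max ((\<lambda>d. (u \<bullet> d) / norm d) ` S)"
    using cosine_measure_attained[OF assms(1,2)] by blast
  also have "\<dots> < k"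
    using assms by (auto simp: u_def divide_simps mult.commute)
  finally show ?thesis .
qed

lemma le_cosine_measure:
  fixes S :: "'a::euclidean_space set"
  assumes "finite S" "\<And>d. d \<in> S \<Longrightarrow> norm d = 1"
    and ge: "\<And>u. norm u = 1 \<Longrightarrow> \<exists>d\<in>S. k \<le> u \<bullet> d"
  shows "k \<le> cosine_measure S"
proof -
  have "S \<noteq> {}"
    using ge vector_choose_size[of 1] by (metis empty_iff zero_le_one)
  then obtain u where u: "norm u = 1" "cosine_measure S = Max ((\<lambda>d. (u \<bullet> d) / norm d) ` S)"
    using cosine_measure_attained[OF assms(1)] by blast
  then show ?thesis
    using ge[OF u(1)] assms \<open>S \<noteq> {}\<close> by (auto simp: Max_ge_iff)
qed

section \<open>Oblique bases\<close>

text \<open>A pigeonhole argument. The vectors \<open>- b\<^sub>1\<close> and \<open>b\<^sub>1\<close> rotated by \<open>\<plusminus>60\<close> degrees have inner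
  product at most \<open>1/2\<close> with \<open>b\<^sub>1\<close>, and they sum to zero. If a unit vector had inner product
  greater than \<open>1/2\<close> with two of them, then it would have inner product less than \<open>-1\<close> with the
  third. So \<open>b\<^sub>2\<close> and \<open>b\<^sub>3\<close> exclude at most one of the three candidates each.\<close>

lemma exists_unit_in_plane_inner_le_half:
  fixes n b\<^sub>1 b\<^sub>2 b\<^sub>3 :: "real^3"
  assumes n: "norm n = 1"
    and b: "norm b\<^sub>1 = 1" "norm b\<^sub>2 = 1" "norm b\<^sub>3 = 1" and perp: "n \<bullet> b\<^sub>1 = 0"
  shows "\<exists>w. norm w = 1 \<and> w \<bullet> n = 0 \<and> w \<bullet> b\<^sub>1 \<le> 1/2 \<and> w \<bullet> b\<^sub>2 \<le> 1/2 \<and> w \<bullet> b\<^sub>3 \<le> 1/2"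
proof -
  define c where "c = cross3 n b\<^sub>1"
  have c: "c \<bullet> c = 1" "c \<bullet> n = 0" "c \<bullet> b\<^sub>1 = 0" "b\<^sub>1 \<bullet> c = 0"
    using norm_cross_dot[of n b\<^sub>1] n b(1) perp
    by (simp_all add: c_def dot_cross_self power2_norm_eq_inner)
  have b1: "b\<^sub>1 \<bullet> b\<^sub>1 = 1" "b\<^sub>1 \<bullet> n = 0"
    using b(1) perp by (simp_all add: norm_eq_1 inner_commute)
  define w\<^sub>1 where "w\<^sub>1 = (1/2) *\<^sub>R b\<^sub>1 + (sqrt 3 / 2) *\<^sub>R c"
  define w\<^sub>2 where "w\<^sub>2 = (1/2) *\<^sub>R b\<^sub>1 - (sqrt 3 / 2) *\<^sub>R c"
  define w\<^sub>3 where "w\<^sub>3 = - b\<^sub>1"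
  note w_defs = w\<^sub>1_def w\<^sub>2_def w\<^sub>3_def
  have "norm w\<^sub>1 = 1" "norm w\<^sub>2 = 1" "norm w\<^sub>3 = 1"
    using c b1 by (simp_all add: w_defs norm_eq_1 inner_add inner_diff)
  moreover have "w\<^sub>1 \<bullet> n = 0" "w\<^sub>2 \<bullet> n = 0" "w\<^sub>3 \<bullet> n = 0"
    using c b1 by (simp_all add: w_defs inner_add_left inner_diff_left)
  moreover have "w\<^sub>1 \<bullet> b\<^sub>1 \<le> 1/2" "w\<^sub>2 \<bullet> b\<^sub>1 \<le> 1/2" "w\<^sub>3 \<bullet> b\<^sub>1 \<le> 1/2"
    using c b1 by (simp_all add: w_defs inner_add_left inner_diff_left)
  ultimately have w: "norm w = 1 \<and> w \<bullet> n = 0 \<and> w \<bullet> b\<^sub>1 \<le> 1/2" if "w \<in> {w\<^sub>1, w\<^sub>2, w\<^sub>3}" for w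
    using that by blast
  have excl: "\<not> (x \<bullet> b > 1/2 \<and> y \<bullet> b > 1/2)"
    if "norm b = 1" "norm z = 1" "x + y + z = 0" for b x y z :: "real^3"
  proof -
    have "x \<bullet> b + y \<bullet> b + z \<bullet> b = 0"
      using that(3) by (metis inner_add_left inner_zero_left)
    moreover have "- 1 \<le> z \<bullet> b"
      using Cauchy_Schwarz_ineq2[of z b] that by simp
    ultimately show ?thesis by linarith
  qed
  have sum: "w\<^sub>1 + w\<^sub>2 + w\<^sub>3 = 0" "w\<^sub>1 + w\<^sub>3 + w\<^sub>2 = 0" "w\<^sub>2 + w\<^sub>3 + w\<^sub>1 = 0"
    by (simp_all add: w_defs vec_eq_iff)
  have "\<not> (w\<^sub>1 \<bullet> d > 1/2 \<and> w\<^sub>2 \<bullet> d > 1/2) \<and> \<not> (w\<^sub>1 \<bullet> d > 1/2 \<and> w\<^sub>3 \<bullet> d > 1/2)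
      \<and> \<not> (w\<^sub>2 \<bullet> d > 1/2 \<and> w\<^sub>3 \<bullet> d > 1/2)" if "norm d = 1" for d
    using excl[OF that _ sum(1)] excl[OF that _ sum(2)] excl[OF that _ sum(3)] w by blast
  from this[OF b(2)] this[OF b(3)]
  have "\<exists>w\<in>{w\<^sub>1, w\<^sub>2, w\<^sub>3}. w \<bullet> b\<^sub>2 \<le> 1/2 \<and> w \<bullet> b\<^sub>3 \<le> 1/2"
    by (simp add: not_less) linarith
  with w show ?thesis by blast
qed

text \<open>The choice of the height \<open>s\<close> of the vector \<open>w + s n\<close> over the plane, where \<open>q\<close> and \<open>c\<close> are the
  inner products of a basis vector outside the plane with \<open>w\<close> and with the normal \<open>n\<close>. When
  \<open>\<bar>q\<bar>\<close> is large compared to \<open>c\<close>, the two terms can be made to cancel. Otherwise any \<open>s\<close> of the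
  right sign would do whose absolute value exceeds \<open>1/2\<close> by little enough. The hypothesis \<open>c < 1\<close>
  is essential, since for \<open>c = 1\<close> and \<open>q = 0\<close> the two requirements contradict each other.\<close>

lemma exists_height:
  fixes c q :: real
  assumes "0 < c" "c < 1"
  shows "\<exists>s. 1/4 < s\<^sup>2 \<and> 5 * (q + s * c)\<^sup>2 < 1 + s\<^sup>2"
proof -
  have nonneg: "\<exists>s. 1/4 < s\<^sup>2 \<and> 5 * (q + s * c)\<^sup>2 < 1 + s\<^sup>2" if "0 \<le> q" for q
  proof (cases "c < 2 * q")
    case True
    define s where "s = - q / c"
    have "q + s * c = 0"
      using assms by (simp add: s_def)
    moreover have "(1/2)\<^sup>2 < s\<^sup>2"
      using True assms by (intro power2_strict_mono) (simp add: s_def field_simps abs_if)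
    moreover have "0 < 1 + s\<^sup>2"
      by (simp add: add_pos_nonneg)
    ultimately show ?thesis
      by (intro exI[of _ s]) (simp add: power2_eq_square)
  next
    case False
    (* This s balances the two requirements: sqrt c / 2 bounds |q + s c|, so that the second one
       reduces to 5 c\<^sup>2 < 1 + 4 c, which holds exactly for c strictly between - 1/5 and 1. *)
    define r where "r = sqrt c"
    define s where "s = - 1 / (2 * r)"
    have r: "0 < r" "r\<^sup>2 = c" "r * r = c"
      using assms by (simp_all add: r_def)
    have "r < 1"
      using assms by (simp add: r_def)
    then have "c \<le> r"
      using r by (metis less_eq_real_def mult_left_le)
    have s2: "s\<^sup>2 = 1 / (4 * c)"
      using r by (simp add: s_def power_divide power_mult_distrib)
    have "s * c = - r / 2"
      using r(1) by (simp add: s_def flip: r(3))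
    then have "\<bar>q + s * c\<bar> \<le> r / 2"
      using False that \<open>c \<le> r\<close> by linarith
    then have "(q + s * c)\<^sup>2 \<le> (r / 2)\<^sup>2"
      using r(1) by (metis abs_le_square_iff abs_of_pos half_gt_zero)
    then have "5 * (q + s * c)\<^sup>2 \<le> 5 * c / 4"
      by (simp add: power_divide r)
    also have "\<dots> < 1 + s\<^sup>2"
    proof -
      have "0 < (1 - c) * (5 * c + 1)"
        using assms by (intro mult_pos_pos) auto
      then show ?thesis
        unfolding s2 using assms by (simp add: field_simps)
    qed
    finally show ?thesis
      using assms s2 by (intro exI[of _ s]) simp
  qed
  show ?thesis
  proof (cases "0 \<le> q")
    case False
    then obtain s where "1/4 < s\<^sup>2" "5 * (- q + s * c)\<^sup>2 < 1 + s\<^sup>2"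
      using nonneg[of "- q"] by auto
    moreover have "(q + (- s) * c)\<^sup>2 = (- q + s * c)\<^sup>2"
      by (simp add: power2_eq_square algebra_simps)
    ultimately show ?thesis
      by (intro exI[of _ "- s"]) simp
  qed (rule nonneg)
qed

lemma cosine_measure_oblique_less:
  fixes n a b\<^sub>1 b\<^sub>2 b\<^sub>3 :: "real^3"
  assumes n: "norm n = 1" and a: "norm a = 1" "n \<bullet> a \<noteq> 0" "\<bar>n \<bullet> a\<bar> \<noteq> 1"
    and b: "norm b\<^sub>1 = 1" "norm b\<^sub>2 = 1" "norm b\<^sub>3 = 1"
    and perp: "n \<bullet> b\<^sub>1 = 0" "n \<bullet> b\<^sub>2 = 0" "n \<bullet> b\<^sub>3 = 0"
  shows "cosine_measure {a, - a, b\<^sub>1, b\<^sub>2, b\<^sub>3} < 1 / sqrt 5"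
proof -
  define c where "c = \<bar>n \<bullet> a\<bar>"
  have c: "0 < c" "c < 1"
    using a n Cauchy_Schwarz_ineq2[of n a] by (simp_all add: c_def)
  obtain w where w: "norm w = 1" "w \<bullet> n = 0"
      "w \<bullet> b\<^sub>1 \<le> 1/2" "w \<bullet> b\<^sub>2 \<le> 1/2" "w \<bullet> b\<^sub>3 \<le> 1/2"
    using exists_unit_in_plane_inner_le_half[OF n b perp(1)] by blast
  obtain s where s: "1/4 < s\<^sup>2" "5 * (w \<bullet> a + s * (n \<bullet> a))\<^sup>2 < 1 + s\<^sup>2"
  proof -
    obtain s where "1/4 < s\<^sup>2" "5 * (w \<bullet> a + s * c)\<^sup>2 < 1 + s\<^sup>2"
      using exists_height[OF c] by blast
    then show ?thesis
      using that[of s] that[of "- s"] by (cases "0 \<le> n \<bullet> a") (auto simp: c_def)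
  qed
  define v where "v = w + s *\<^sub>R n"
  have "v \<bullet> v = 1 + s\<^sup>2"
    using w(1,2) n by (simp add: v_def norm_eq_1 inner_add inner_commute power2_eq_square)
  then have v: "(norm v)\<^sup>2 = 1 + s\<^sup>2"
    by (simp add: power2_norm_eq_inner)
  have less: "x < 1 / sqrt 5 * norm v" if "x \<le> t" "5 * t\<^sup>2 < 1 + s\<^sup>2" for x t
  proof -
    have "5 * t\<^sup>2 < (norm v)\<^sup>2"
      using that(2) v by simp
    then have "(sqrt 5 * t)\<^sup>2 < (norm v)\<^sup>2"
      by (simp add: power_mult_distrib)
    then have "sqrt 5 * t < norm v"
      by (rule power_less_imp_less_base) simp
    then have "t < 1 / sqrt 5 * norm v"
      by (simp add: field_simps)
    with that(1) show ?thesis by simp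
  qed
  show ?thesis
  proof (rule cosine_measure_less)
    show "v \<noteq> 0"
      using v by (auto simp: sum_power2_eq_zero_iff add_nonneg_eq_0_iff)
    have "5 * (v \<bullet> a)\<^sup>2 < 1 + s\<^sup>2"
      using s(2) by (simp add: v_def inner_add_left)
    then have "v \<bullet> a < 1 / sqrt 5 * norm v" "v \<bullet> (- a) < 1 / sqrt 5 * norm v"
      using less[of "v \<bullet> a" "v \<bullet> a"] less[of "- (v \<bullet> a)" "- (v \<bullet> a)"] by simp_all
    moreover have "v \<bullet> d < 1 / sqrt 5 * norm v" if "d \<in> {b\<^sub>1, b\<^sub>2, b\<^sub>3}" for d
      using that w perp s(1)
      by (intro less[of _ "1/2"]) (auto simp: v_def inner_add_left power2_eq_square)
    ultimately show "v \<bullet> d < 1 / sqrt 5 * norm v" if "d \<in> {a, - a, b\<^sub>1, b\<^sub>2, b\<^sub>3}" for d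
      using that by blast
  qed (use a b in auto)
qed

section \<open>The cross-shaped basis\<close>

definition vertical :: "real^3" where
  "vertical = vector [0, 0, 1]"

definition tripod :: "(real^3) set" where
  "tripod = {vector [1, 0, 0], vector [- 1/2, sqrt 3 / 2, 0], vector [- 1/2, - sqrt 3 / 2, 0]}"

definition cross_basis :: "(real^3) set" where
  "cross_basis = {vertical, - vertical} \<union> tripod"

lemmas cross_basis_defs = cross_basis_def vertical_def tripod_def

lemma inner_real3: "x \<bullet> y = x$1 * y$1 + x$2 * y$2 + x$3 * y$3" for x y :: "real^3"
  by (simp add: inner_vec_def sum_3)

lemma vec_eq_real3: "x = y \<longleftrightarrow> x$1 = y$1 \<and> x$2 = y$2 \<and> x$3 = y$3" for x y :: "real^3"
  by (simp add: vec_eq_iff forall_3)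

lemma norm_cross_basis: "d \<in> cross_basis \<Longrightarrow> norm d = 1"
  by (auto simp: cross_basis_defs norm_eq_1 inner_real3 vector_3)

lemma card_tripod: "card tripod = 3"
  by (simp add: tripod_def card_insert_if vec_eq_real3 vector_3)

lemma card_vertical: "card {vertical, - vertical} = 2"
  by (simp add: vertical_def card_insert_if vec_eq_real3 vector_3)

lemma vertical_tripod_disjoint: "{vertical, - vertical} \<inter> tripod = {}"
  by (auto simp: vertical_def tripod_def vec_eq_real3 vector_3)

lemma finite_tripod: "finite tripod"
  by (simp add: tripod_def)

lemma card_cross_basis: "card cross_basis = 5"
  using card_Un_disjoint[OF _ finite_tripod vertical_tripod_disjoint]
  by (simp add: cross_basis_def card_tripod card_vertical)

lemma sum_vertical: "\<Sum>{vertical, - vertical} = 0"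
  by (subst sum.insert) (simp_all add: vertical_def vec_eq_real3 vector_3)

lemma sum_tripod: "\<Sum>tripod = 0"
  by (simp add: tripod_def sum.insert_if vec_eq_real3 vector_3)

lemma span_vertical: "span {vertical, - vertical} = span {vertical}"
  by (metis insert_commute span_base span_neg span_redundant singletonI)

lemma span_tripod: "span tripod = {x. vertical \<bullet> x = 0}"
proof
  show "span tripod \<subseteq> {x. vertical \<bullet> x = 0}"
    by (rule span_minimal[OF _ subspace_hyperplane])
      (auto simp: tripod_def vertical_def inner_real3 vector_3)
  show "{x. vertical \<bullet> x = 0} \<subseteq> span tripod"
  proof
    fix x assume "x \<in> {x. vertical \<bullet> x = 0}"
    then have x3: "x$3 = 0"
      by (simp add: vertical_def inner_real3 vector_3)
    have "x = (x$1 + x$2 / sqrt 3) *\<^sub>R vector [1, 0, 0]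
        + (2 * x$2 / sqrt 3) *\<^sub>R vector [- 1/2, sqrt 3 / 2, 0]"
      by (simp add: vec_eq_real3 vector_3 x3)
    also have "\<dots> \<in> span tripod"
      by (intro span_add span_scale span_base) (auto simp: tripod_def)
    finally show "x \<in> span tripod" .
  qed
qed

lemma direct_sum_cross_basis:
  "direct_sum_decomposition (span {vertical, - vertical}) (span tripod)"
  unfolding direct_sum_decomposition_def
proof (intro conjI)
  have vv: "vertical \<bullet> vertical = 1"
    by (simp add: vertical_def inner_real3 vector_3)
  have "x \<in> {x + y |x y. x \<in> span {vertical} \<and> y \<in> span tripod}" for x
  proof (intro CollectI exI conjI)
    show "x = (vertical \<bullet> x) *\<^sub>R vertical + (x - (vertical \<bullet> x) *\<^sub>R vertical)"
      by simp
    show "x - (vertical \<bullet> x) *\<^sub>R vertical \<in> span tripod"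
      by (simp add: span_tripod inner_diff_right vv)
  qed (simp add: span_scale span_base)
  then show "{x + y |x y. x \<in> span {vertical, - vertical} \<and> y \<in> span tripod} = UNIV"
    unfolding span_vertical by blast
  show "span {vertical, - vertical} \<inter> span tripod = {0}"
    unfolding span_vertical by (auto simp: span_tripod span_singleton vv)
qed simp_all

lemma positive_basis_cross_basis: "positive_basis UNIV cross_basis"
proof -
  have "span cross_basis = UNIV"
    using direct_sum_cross_basis
    unfolding direct_sum_decomposition_def cross_basis_def span_Un by blast
  moreover have "\<Sum>cross_basis = 0"
    unfolding cross_basis_def
    using sum.union_disjoint[OF _ finite_tripod vertical_tripod_disjoint, of "\<lambda>x. x"]
    by (simp add: sum_vertical sum_tripod)
  moreover have "finite cross_basis"
    by (simp add: cross_basis_def finite_tripod)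
  moreover have "positively_independent cross_basis"
  proof (rule positively_independent_if_inner_le_0)
    show "x \<bullet> y \<le> 0" if "x \<in> cross_basis" "y \<in> cross_basis" "x \<noteq> y" for x y
      using that by (auto simp: cross_basis_defs inner_real3 vector_3)
    show "0 \<notin> cross_basis"
      using norm_cross_basis by fastforce
  qed fact
  ultimately show ?thesis
    by (auto simp: positive_basis_def pspan_eq_span_if_sum_eq_0 norm_cross_basis)
qed

lemma cross_basis_in_Omega: "cross_basis \<in> Omega"
proof -
  have dims: "dim (span {vertical, - vertical}) = 1" "dim (span tripod) = 2"
  proof -
    have "vertical \<noteq> 0"
      by (simp add: vertical_def vec_eq_real3 vector_3)
    then show "dim (span {vertical, - vertical}) = 1" "dim (span tripod) = 2"
      by (simp_all add: span_vertical span_tripod dim_hyperplane)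
  qed
  have minimal: "minimal_sub_positive_basis (span S) S"
    if "S \<subseteq> cross_basis" "finite S" "\<Sum>S = 0" "card S = dim (span S) + 1" for S
    using that positive_basis_cross_basis
    by (auto simp: minimal_sub_positive_basis_def sub_positive_basis_def pspan_eq_span_if_sum_eq_0)
  have "minimal_sub_positive_basis (span {vertical, - vertical}) {vertical, - vertical}"
    by (rule minimal) (simp_all only: dims card_vertical sum_vertical, auto simp: cross_basis_def)
  moreover have "minimal_sub_positive_basis (span tripod) tripod"
    by (rule minimal) (simp_all only: dims card_tripod sum_tripod, auto simp: cross_basis_def finite_tripod)
  moreover have "1 \<le> dim (span {vertical, - vertical})" "1 \<le> dim (span tripod)"
    by (simp_all only: dims)
  ultimately show ?thesis
    using positive_basis_cross_basis card_cross_basis direct_sum_cross_basis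
      vertical_tripod_disjoint cross_basis_def
    unfolding Omega_def by blast
qed

text \<open>If all inner products of a unit vector with the basis are less than \<open>h = 1 / sqrt 5\<close>, then
  its vertical part has length less than \<open>h\<close>. Its horizontal part lies in the triangle that is cut
  out by the tripod, whose vertices have length \<open>2 h\<close>. Hence the squared norm is less than
  \<open>5 h\<^sup>2 = 1\<close>.\<close>

lemma cosine_measure_cross_basis: "1 / sqrt 5 \<le> cosine_measure cross_basis"
proof (rule le_cosine_measure)
  show "finite cross_basis"
    by (simp add: cross_basis_def finite_tripod)
  fix u :: "real^3" assume "norm u = 1"
  show "\<exists>d\<in>cross_basis. 1 / sqrt 5 \<le> u \<bullet> d"
  proof (rule ccontr)
    define h :: real where "h = 1 / sqrt 5"
    have h: "0 < h" "5 * h\<^sup>2 = 1"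
      by (simp_all add: h_def power_divide)
    assume "\<not> ?thesis"
    then have "\<forall>d\<in>cross_basis. u \<bullet> d < h"
      by (auto simp: h_def not_le)
    moreover define p where "p = u \<bullet> vector [1, 0, 0]"
    moreover define q where "q = u \<bullet> vector [- 1/2, sqrt 3 / 2, 0]"
    moreover define r where "r = u \<bullet> vector [- 1/2, - sqrt 3 / 2, 0]"
    ultimately have less: "\<bar>u$3\<bar> < h" "p < h" "q < h" "r < h"
      by (simp_all add: cross_basis_defs inner_real3 vector_3 abs_less_iff)
    have pqr: "p = u$1" "q = - (u$1) / 2 + sqrt 3 / 2 * u$2" "r = - (u$1) / 2 - sqrt 3 / 2 * u$2"
      by (simp_all add: p_def q_def r_def inner_real3 vector_3 field_simps)
    (* The three products are positive; as p + q + r = 0, their sum is 3 h\<^sup>2 minus three quarters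
       of the squared norm of the horizontal part. *)
    have "0 < (h - p) * (h - q) + (h - p) * (h - r) + (h - q) * (h - r)"
      using less by (intro add_pos_pos mult_pos_pos) simp_all
    also have "\<dots> = 3 * h\<^sup>2 - 3/4 * ((u$1)\<^sup>2 + (u$2)\<^sup>2)"
    proof -
      define m where "m = sqrt 3 / 2 * u$2"
      have "m\<^sup>2 = 3/4 * (u$2)\<^sup>2"
        by (simp add: m_def power_mult_distrib power_divide)
      then show ?thesis
        unfolding pqr m_def[symmetric] by (simp add: power2_eq_square algebra_simps)
    qed
    finally have "(u$1)\<^sup>2 + (u$2)\<^sup>2 < 4 * h\<^sup>2"
      by simp
    moreover have "(u$3)\<^sup>2 < h\<^sup>2"
      using less(1) h(1) by (intro power2_strict_mono) simp
    moreover have "(u$1)\<^sup>2 + (u$2)\<^sup>2 + (u$3)\<^sup>2 = 1"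
      using \<open>norm u = 1\<close> by (simp add: norm_eq_1 inner_real3 power2_eq_square)
    ultimately show False
      using h(2) by linarith
  qed
qed (rule norm_cross_basis)

section \<open>Optimal bases are not oblique\<close>

lemma span_singleton_eq_if_dim_eq_1:
  fixes L :: "'a::euclidean_space set"
  assumes "subspace L" "dim L = 1" "a \<in> L" "a \<noteq> 0"
  shows "L = span {a}"
  by (rule sym, rule subspace_dim_equal) (use assms in \<open>auto simp: span_minimal\<close>)

lemma card_2_unit_vectors_in_line:
  fixes L S :: "'a::euclidean_space set"
  assumes "subspace L" "dim L = 1" "S \<subseteq> L" "card S = 2" "\<And>d. d \<in> S \<Longrightarrow> norm d = 1"
  shows "\<exists>a. norm a = 1 \<and> S = {a, - a} \<and> L = span {a}"
proof -
  obtain a b where S: "S = {a, b}" "a \<noteq> b"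
    using assms(4) by (auto simp: card_2_iff)
  have a: "norm a = 1" "norm b = 1" "a \<noteq> 0" "a \<in> L" "b \<in> L"
    using assms(3) assms(5)[of a] assms(5)[of b] S by auto
  have L: "L = span {a}"
    using span_singleton_eq_if_dim_eq_1 assms(1,2) a by blast
  then obtain k where k: "b = k *\<^sub>R a"
    using a by (auto simp: span_singleton)
  then have "\<bar>k\<bar> = 1" "k \<noteq> 1"
    using a S by auto
  then have "k = - 1"
    by linarith
  then show ?thesis
    using S k L a by auto
qed

theorem proposition30:
  fixes D D\<^sub>1 D\<^sub>2 L\<^sub>1 L\<^sub>2 :: "(real^3) set"
  assumes "positive_basis UNIV D" and "card D = 5"
    and "D = D\<^sub>1 \<union> D\<^sub>2" and "D\<^sub>1 \<inter> D\<^sub>2 = {}"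
    and "minimal_sub_positive_basis L\<^sub>1 D\<^sub>1" and "dim L\<^sub>1 = 1"
    and "minimal_sub_positive_basis L\<^sub>2 D\<^sub>2" and "dim L\<^sub>2 = 2"
    and "direct_sum_decomposition L\<^sub>1 L\<^sub>2"
    and "optimal_over Omega D"
  shows "\<forall>x\<in>L\<^sub>1. \<forall>y\<in>L\<^sub>2. orthogonal x y"
proof -
  have unit: "norm d = 1" if "d \<in> D" for d
    using assms(1) that by (simp add: positive_basis_def)
  have sub: "subspace L\<^sub>1" "subspace L\<^sub>2" "pspan D\<^sub>1 = L\<^sub>1" "pspan D\<^sub>2 = L\<^sub>2"
    and card: "card D\<^sub>1 = 2" "card D\<^sub>2 = 3"
    using assms(5-8) by (auto simp: minimal_sub_positive_basis_def sub_positive_basis_def)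
  have "finite D\<^sub>1" "finite D\<^sub>2"
    using card by (auto intro: card_ge_0_finite)
  then have subset: "D\<^sub>1 \<subseteq> L\<^sub>1" "D\<^sub>2 \<subseteq> L\<^sub>2"
    using sub pspan_base by blast+
  have "\<exists>a. norm a = 1 \<and> D\<^sub>1 = {a, - a} \<and> L\<^sub>1 = span {a}"
    by (rule card_2_unit_vectors_in_line) (use sub subset card assms(3,6) unit in auto)
  then obtain a where a: "norm a = 1" "D\<^sub>1 = {a, - a}" "L\<^sub>1 = span {a}"
    by blast
  obtain b\<^sub>1 b\<^sub>2 b\<^sub>3 where D2: "D\<^sub>2 = {b\<^sub>1, b\<^sub>2, b\<^sub>3}"
    using card(2) by (auto simp: card_3_iff)
  obtain n where n: "norm n = 1" "\<And>y. y \<in> L\<^sub>2 \<Longrightarrow> n \<bullet> y = 0"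
  proof -
    obtain m where m: "m \<noteq> 0" "\<And>y. y \<in> span L\<^sub>2 \<Longrightarrow> orthogonal m y"
      using orthogonal_to_subspace_exists[of L\<^sub>2] assms(8) by auto
    show ?thesis
      using m by (intro that[of "m /\<^sub>R norm m"]) (auto simp: orthogonal_def span_base)
  qed
  have "n \<bullet> a \<noteq> 0"
  proof
    assume "n \<bullet> a = 0"
    obtain x y where "n = x + y" "x \<in> L\<^sub>1" "y \<in> L\<^sub>2"
      using assms(9) unfolding direct_sum_decomposition_def by blast
    then have "n \<bullet> n = 0"
      using n(2) \<open>n \<bullet> a = 0\<close> a(3) by (auto simp: inner_add_right span_singleton)
    with n(1) show False by simp
  qed
  have "1 / sqrt 5 \<le> cosine_measure D"
    using assms(2,10) cross_basis_in_Omega positive_basis_cross_basis card_cross_basis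
      cosine_measure_cross_basis unfolding optimal_over_def by fastforce
  moreover have "D = {a, - a, b\<^sub>1, b\<^sub>2, b\<^sub>3}"
    using assms(3) a(2) D2 by auto
  moreover have "norm b\<^sub>1 = 1" "norm b\<^sub>2 = 1" "norm b\<^sub>3 = 1" "n \<bullet> b\<^sub>1 = 0" "n \<bullet> b\<^sub>2 = 0" "n \<bullet> b\<^sub>3 = 0"
    using unit n(2) subset(2) D2 assms(3) by auto
  ultimately have "\<bar>n \<bullet> a\<bar> = 1"
    using cosine_measure_oblique_less[OF n(1) a(1) \<open>n \<bullet> a \<noteq> 0\<close>] by fastforce
  (* Equality in the Cauchy-Schwarz inequality: a is parallel to the normal. *)
  then have "(n \<bullet> a)\<^sup>2 = 1"
    by (metis power2_abs one_power2)
  then have "(a - (n \<bullet> a) *\<^sub>R n) \<bullet> (a - (n \<bullet> a) *\<^sub>R n) = 0"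
    using n(1) a(1) by (simp add: norm_eq_1 inner_diff inner_commute power2_eq_square)
  then have "a = (n \<bullet> a) *\<^sub>R n"
    by simp
  then have "a \<bullet> y = 0" if "y \<in> L\<^sub>2" for y
    using n(2)[OF that] by (metis inner_scaleR_left mult_zero_right)
  then show ?thesis
    using a(3) by (auto simp: orthogonal_def span_singleton)
qed

end
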